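(* Let the graph neural network parameter $\theta$ be given. Denote by $q(T_{\text{in}})$ the approximate sample densities after $T_{\text{in}}$ steps of gradient flow, that is, after $T_{\text{in}}$ steps of the iteration $$q_i(0)\leftarrow \frac1N,\qquad q_i(t+1)\leftarrow q_i(t)+\tau\cdot\frac{dq_i(t)}{dt},\quad i=1,\dots,N,$$ with time step $\tau$, where $$\frac{dq_i(t)}{dt}=\sum_{j:(i,j)\in E}w_{ij}\,v_{ij}\Big(\mathbb I(v_{ij}>0)\,q_j+\mathbb I(v_{ij}\le 0)\,q_i\Big),\qquad v_{ij}=\ell_i-\ell_j+\beta(\log q_j-\log q_i)\ \text{ for }(i,j)\in E .$$ Let $\epsilon=\mathcal{GW}_{G_0}^2(\hat{\mathbb P}_s,q(T_{\text{in}}))$ be its geometric Wasserstein distance from the original source distribution $\hat{\mathbb P}_s$, and denote the ground-truth worst-case distribution with the same distance $\epsilon$ by $$q^\star=\arg\max_{q:\ \mathcal{GW}_{G_0}^2(\hat{\mathbb P}_s,q)\le\epsilon}\mathcal L(\theta,q).$$ Then $$\frac{\mathcal L(\theta,q(T_{\text{in}}))-\mathcal L(\theta,\hat{\mathbb P}_s)}{\mathcal L(\theta,q^\star)-\mathcal L(\theta,\hat{\mathbb P}_s)}>1-e^{-CT_{\text{in}}},$$ where $C>0$ is a constant and its value depends on the loss function $\ell$, the hyper-parameter $\beta$, and the sample size $N$.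
   Context: Graph. $G_0=(V,E,W)$ is a weighted finite graph with node set $V$ (nodes indexed by $1,\dots,N$), edge set $E$, and edge weights $W=(w_{ij})_{(i,j)\in E}$. Objective. $D_s=\{(x_i,y_i)\}_{i=1}^N$ is the source data set indexed by the nodes, with empirical distribution $\hat{\mathbb P}_s$ (mass $1/N$ on each node); $f_\theta$ is a prediction model (a graph neural network) with parameter $\theta$; $\ell$ is the loss function and $\ell_i=\ell(f_\theta(x_i),y_i)$ is the prediction error on the $i$-th node; $\beta$ is a hyper-parameter (the coefficient of the entropy penalty); $\mathbb I$ is the indicator function. For $q=(q_1,\dots,q_N)$, $$\mathcal L(\theta,q)=\sum_{i=1}^N q_i\,\ell(f_\theta(x_i),y_i)-\beta\sum_{i=1}^N q_i\log q_i .$$ Probability set. $\mathcal P(G_0)=\{p=(p_i)_{i=1}^N:\sum_{i=1}^N p_i=1,\ p_i\ge 0\}$, and $\mathscr P_o(G_0)$ is its interior. Velocity fields and divergence. A velocity field on $G_0$ is a matrix $v=(v_{ij})\in\mathbb R^{N\times N}$ with $v_{ij}=-v_{ji}$ if $(i,j)\in E$ and $v_{ij}=0$ otherwise. The interpolation function used is the upwind one, $\xi_{ij}(p)=\mathbb I(v_{ij}>0)\,p_j+\mathbb I(v_{ij}\le 0)\,p_i$. The divergence is $$\mathrm{div}_{G_0}(pv)=-\Big(\sum_{j\in V:(i,j)\in E}\sqrt{w_{ij}}\,v_{ij}\,\xi_{ij}(p)\Big)_{i=1}^N\in\mathbb R^N .$$ Discrete geometric Wasserstein distance. For $p^0,p^1\in\mathscr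 P_o(G_0)$, $$\mathcal{GW}_{G_0}^2(p^0,p^1)=\inf_v\left\{\int_0^1\frac12\sum_{(i,j)\in E}\xi_{ij}(p(t))\,v_{ij}^2\,dt:\ \frac{dp}{dt}+\mathrm{div}_{G_0}(pv)=0,\ p(0)=p^0,\ p(1)=p^1\right\},$$ where the infimum is over all velocity fields on $G_0$ and $p(t):[0,1]\to\mathscr P_o(G_0)$ is a continuously differentiable curve.
   Formalization: Proved for β > 0 and every sufficiently small time step τ (threshold depending on graph, weights, losses and β, not on T_in), with the ratio's denominator nonzero; C may also depend on the graph, weights, data, θ and τ, but not on T_in or q*. *)

theory Defs
  imports "HOL-Analysis.Analysis"
begin

text \<open>
  The nodes are the elements of a finite type \<open>'n\<close>, so that the sample size is \<open>CARD('n)\<close>.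
  An undirected edge is represented by both ordered pairs; hence a sum over \<open>E\<close> counts it twice.
\<close>

definition weighted_graph :: "('n::finite \<times> 'n) set \<Rightarrow> ('n \<Rightarrow> 'n \<Rightarrow> real) \<Rightarrow> bool" where
  "weighted_graph E w \<longleftrightarrow> sym E \<and> (\<forall>(i, j)\<in>E. 0 < w i j \<and> w i j = w j i)"

definition prob_set :: "(real ^ 'n::finite) set" where
  "prob_set = {p. (\<Sum>i\<in>UNIV. p $ i) = 1 \<and> (\<forall>i. 0 \<le> p $ i)}"

text \<open>
  The simplex has empty interior in the ambient space; its interior is taken
  relative to its affine hull.
\<close>

definition prob_interior :: "(real ^ 'n::finite) set" where
  "prob_interior = rel_interior prob_set"

lemma prob_interior_iff:
  fixes p :: "real ^ 'n::finite"
  shows "p \<in> prob_interior \<longleftrightarrow> (\<Sum>i\<in>UNIV. p $ i) = 1 \<and> (\<forall>i. 0 < p $ i)"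
proof -
  let ?H = "{p :: real ^ 'n. (\<Sum>i\<in>UNIV. p $ i) = 1}"
  let ?K = "{p :: real ^ 'n. \<forall>i. 0 \<le> p $ i}"
  have H: "?H = {p. (\<chi> i. 1) \<bullet> p = 1}"
    by (simp add: inner_vec_def)
  have aff: "affine ?H"
    unfolding H by (rule affine_hyperplane)
  have K: "interior ?K = {p. \<forall>i. 0 < p $ i}"
  proof
    have "interior ?K \<subseteq> {p. 0 < p $ i}" for i
      using interior_mono[of ?K "{p. 0 \<le> p $ i}"]
      by (auto simp: interior_halfspace_component_ge)
    then show "interior ?K \<subseteq> {p. \<forall>i. 0 < p $ i}"
      by blast
    have "open (\<Inter>i. {p :: real ^ 'n. 0 < p $ i})"
      by (intro open_INT ballI open_Collect_less continuous_intros) auto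
    also have "(\<Inter>i. {p :: real ^ 'n. 0 < p $ i}) = {p. \<forall>i. 0 < p $ i}"
      by auto
    finally show "{p. \<forall>i. 0 < p $ i} \<subseteq> interior ?K"
      by (intro interior_maximal) (auto intro: less_imp_le)
  qed
  have "convex ?K"
    by (auto simp: convex_def)
  moreover have "(\<chi> i. 1 / real CARD('n)) \<in> interior ?K \<inter> ?H"
    by (simp add: K)
  ultimately have "rel_interior (?K \<inter> ?H) = interior ?K \<inter> ?H"
    using aff by (intro rel_interior_convex_Int_affine) auto
  moreover have "prob_set = ?K \<inter> ?H"
    by (auto simp: prob_set_def)
  ultimately show ?thesis
    by (auto simp: prob_interior_def K)
qed

definition empirical :: "real ^ 'n::finite" where
  "empirical = (\<chi> i. 1 / real CARD('n))"

definition velocity_field :: "('n::finite \<times> 'n) set \<Rightarrow> real ^ 'n ^ 'n \<Rightarrow> bool" where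
  "velocity_field E v \<longleftrightarrow>
     (\<forall>i j. if (i, j) \<in> E then v $ i $ j = - v $ j $ i else v $ i $ j = 0)"

definition upwind :: "real ^ 'n ^ 'n \<Rightarrow> real ^ 'n \<Rightarrow> 'n::finite \<Rightarrow> 'n \<Rightarrow> real" where
  "upwind v p i j = of_bool (v $ i $ j > 0) * p $ j + of_bool (v $ i $ j \<le> 0) * p $ i"

definition graph_div ::
    "('n::finite \<times> 'n) set \<Rightarrow> ('n \<Rightarrow> 'n \<Rightarrow> real) \<Rightarrow> real ^ 'n \<Rightarrow> real ^ 'n ^ 'n \<Rightarrow> real ^ 'n" where
  "graph_div E w p v = (\<chi> i. - (\<Sum>j | (i, j) \<in> E. sqrt (w i j) * v $ i $ j * upwind v p i j))"

text \<open>
  As in the Benamou-Brenier formulation, the velocity field may vary with time.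
  Only its measurability is required, so that the action below is meaningful.
\<close>

definition admissible_path ::
    "('n::finite \<times> 'n) set \<Rightarrow> ('n \<Rightarrow> 'n \<Rightarrow> real) \<Rightarrow> real ^ 'n \<Rightarrow> real ^ 'n
      \<Rightarrow> (real \<Rightarrow> real ^ 'n) \<Rightarrow> (real \<Rightarrow> real ^ 'n ^ 'n) \<Rightarrow> bool" where
  "admissible_path E w p0 p1 p v \<longleftrightarrow>
     v \<in> borel_measurable borel \<and>
     (\<forall>t\<in>{0..1}. velocity_field E (v t) \<and> p t \<in> prob_interior) \<and>
     (\<exists>p'. continuous_on {0..1} p' \<and>
        (\<forall>t\<in>{0..1}. (p has_vector_derivative p' t) (at t within {0..1}) \<and>
                    p' t + graph_div E w (p t) (v t) = 0)) \<and>
     p 0 = p0 \<and> p 1 = p1"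

definition path_action ::
    "('n::finite \<times> 'n) set \<Rightarrow> (real \<Rightarrow> real ^ 'n) \<Rightarrow> (real \<Rightarrow> real ^ 'n ^ 'n) \<Rightarrow> ennreal" where
  "path_action E p v =
     (\<integral>\<^sup>+ t\<in>{0..1}. ennreal (1 / 2 * (\<Sum>(i, j)\<in>E. upwind (v t) (p t) i j * (v t $ i $ j)\<^sup>2)) \<partial>lborel)"

text \<open>
  The squared distance takes values in \<^typ>\<open>ennreal\<close>: it is infinite
  if there is no admissible path, for instance if the masses of the connected components differ.
\<close>

definition GW2 ::
    "('n::finite \<times> 'n) set \<Rightarrow> ('n \<Rightarrow> 'n \<Rightarrow> real) \<Rightarrow> real ^ 'n \<Rightarrow> real ^ 'n \<Rightarrow> ennreal" where
  "GW2 E w p0 p1 = Inf {path_action E p v | p v. admissible_path E w p0 p1 p v}"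

definition node_loss ::
    "('c \<Rightarrow> 'b \<Rightarrow> real) \<Rightarrow> ('t \<Rightarrow> 'a \<Rightarrow> 'c) \<Rightarrow> ('n \<Rightarrow> 'a) \<Rightarrow> ('n \<Rightarrow> 'b) \<Rightarrow> 't \<Rightarrow> 'n \<Rightarrow> real" where
  "node_loss loss f x y \<theta> i = loss (f \<theta> (x i)) (y i)"

definition objective ::
    "('c \<Rightarrow> 'b \<Rightarrow> real) \<Rightarrow> ('t \<Rightarrow> 'a \<Rightarrow> 'c) \<Rightarrow> ('n::finite \<Rightarrow> 'a) \<Rightarrow> ('n \<Rightarrow> 'b) \<Rightarrow> real
      \<Rightarrow> 't \<Rightarrow> real ^ 'n \<Rightarrow> real" where
  "objective loss f x y \<beta> \<theta> q =
     (\<Sum>i\<in>UNIV. q $ i * loss (f \<theta> (x i)) (y i)) - \<beta> * (\<Sum>i\<in>UNIV. q $ i * ln (q $ i))"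

definition flow_velocity ::
    "('n::finite \<times> 'n) set \<Rightarrow> ('n \<Rightarrow> real) \<Rightarrow> real \<Rightarrow> real ^ 'n \<Rightarrow> real ^ 'n ^ 'n" where
  "flow_velocity E l \<beta> q =
     (\<chi> i j. if (i, j) \<in> E then l i - l j + \<beta> * (ln (q $ j) - ln (q $ i)) else 0)"

text \<open>
  The weight enters the flow as \<open>w\<close> and the divergence as its square root: the field driving
  the flow in the sense of \<^const>\<open>graph_div\<close> is \<open>sqrt w\<close> times \<^const>\<open>flow_velocity\<close>.
\<close>

definition flow_rate ::
    "('n::finite \<times> 'n) set \<Rightarrow> ('n \<Rightarrow> 'n \<Rightarrow> real) \<Rightarrow> ('n \<Rightarrow> real) \<Rightarrow> real \<Rightarrow> real ^ 'n \<Rightarrow> real ^ 'n" where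
  "flow_rate E w l \<beta> q =
     (let v = flow_velocity E l \<beta> q
      in \<chi> i. \<Sum>j | (i, j) \<in> E. w i j * v $ i $ j * upwind v q i j)"

primrec flow_iterate ::
    "('n::finite \<times> 'n) set \<Rightarrow> ('n \<Rightarrow> 'n \<Rightarrow> real) \<Rightarrow> ('n \<Rightarrow> real) \<Rightarrow> real \<Rightarrow> real
      \<Rightarrow> nat \<Rightarrow> real ^ 'n" where
  "flow_iterate E w l \<beta> \<tau> 0 = empirical"
| "flow_iterate E w l \<beta> \<tau> (Suc t) =
     flow_iterate E w l \<beta> \<tau> t + \<tau> *\<^sub>R flow_rate E w l \<beta> (flow_iterate E w l \<beta> \<tau> t)"

definition worst_case ::
    "('n::finite \<times> 'n) set \<Rightarrow> ('n \<Rightarrow> 'n \<Rightarrow> real) \<Rightarrow> (real ^ 'n \<Rightarrow> real) \<Rightarrow> ennreal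
      \<Rightarrow> real ^ 'n \<Rightarrow> bool" where
  "worst_case E w L \<epsilon> = is_arg_max L (\<lambda>q. q \<in> prob_interior \<and> GW2 E w empirical q \<le> \<epsilon>)"

end

theory Submission
  imports Defs
begin

text \<open>
  The flow is the gradient flow of the strictly concave free energy, and its explicit Euler steps
  stay, for small \<open>\<tau>\<close>, in a region where the densities are bounded away from zero. There each step
  gains a fixed multiple of \<open>\<tau>\<close> times the dissipation, and the dissipation controls the energy gap
  to every distribution reachable by a flux along the edges (a Polyak-Lojasiewicz inequality).
  Finiteness of the distance forces the worst-case distribution to be reachable, so the gap to it
  shrinks geometrically. For \<open>T = 0\<close> the ball degenerates to the empirical distribution.
\<close>

section \<open>Edge fluxes and their divergence\<close>

text \<open>The flux \<open>M\<close> is an arbitrary matrix, antisymmetrised inside the sum. The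
  map is thus linear on the whole matrix space, and its range is a subspace: the displacements of
  mass that transport along edges can produce.\<close>

definition flux_div :: "('n::finite \<times> 'n) set \<Rightarrow> real ^ 'n ^ 'n \<Rightarrow> real ^ 'n" where
  "flux_div E M = (\<chi> i. \<Sum>j | (i, j) \<in> E. M $ i $ j - M $ j $ i)"

lemma sum_edges: "(\<Sum>(i, j)\<in>E. h i j) = (\<Sum>i\<in>UNIV. \<Sum>j | (i, j) \<in> E. h i j)"
  for E :: "('n::finite \<times> 'n) set" and h :: "'n \<Rightarrow> 'n \<Rightarrow> real"
proof -
  have "(\<Sum>i\<in>UNIV. \<Sum>j | (i, j) \<in> E. h i j) = (\<Sum>(i, j)\<in>Sigma UNIV (\<lambda>i. {j. (i, j) \<in> E}). h i j)"
    by (rule sum.Sigma) auto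
  also have "Sigma UNIV (\<lambda>i. {j. (i, j) \<in> E}) = E"
    by auto
  finally show ?thesis ..
qed

lemma sum_edges_swap:
  assumes "sym E"
  shows "(\<Sum>(i, j)\<in>E. h i j) = (\<Sum>(i, j)\<in>E. h j i)"
  using assms by (intro sum.reindex_bij_witness[of _ prod.swap prod.swap]) (auto dest: symD)

text \<open>Summation by parts: up to sign, the divergence is the adjoint of the graph
  gradient.\<close>

lemma inner_flux_div:
  assumes "sym E"
  shows "(\<Sum>i\<in>UNIV. h i * flux_div E M $ i) = (\<Sum>(i, j)\<in>E. M $ i $ j * (h i - h j))"
proof -
  have "(\<Sum>i\<in>UNIV. h i * flux_div E M $ i) =
      (\<Sum>(i, j)\<in>E. M $ i $ j * h i) - (\<Sum>(i, j)\<in>E. M $ j $ i * h i)"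
    by (simp add: flux_div_def sum_edges sum_distrib_left sum_subtractf algebra_simps)
  also have "(\<Sum>(i, j)\<in>E. M $ j $ i * h i) = (\<Sum>(i, j)\<in>E. M $ i $ j * h j)"
    using sum_edges_swap[OF assms, of "\<lambda>i j. M $ j $ i * h i"] by simp
  finally show ?thesis
    by (simp add: sum_subtractf case_prod_unfold algebra_simps)
qed

lemma sum_flux_div: "sym E \<Longrightarrow> (\<Sum>i\<in>UNIV. flux_div E M $ i) = 0"
  using inner_flux_div[of E "\<lambda>_. 1" M] by simp

lemma linear_flux_div: "linear (flux_div E)"
  by (intro linearI) (auto simp: flux_div_def vec_eq_iff sum.distrib[symmetric] sum_distrib_left algebra_simps)

lemma subspace_range_flux_div: "subspace (range (flux_div E))"
  by (intro linear_subspace_image linear_flux_div subspace_UNIV)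

text \<open>A linear choice of flux for each reachable displacement; its boundedness is automatic in
  finite dimension. It turns membership in the range into a linear equation and bounds the flux by
  the displacement.\<close>

lemma flux_div_right_inverse:
  obtains G K where "linear G" "0 < K" "\<And>d. norm (G d) \<le> K * norm d"
    "\<And>d. d \<in> range (flux_div E) \<Longrightarrow> flux_div E (G d) = d"
proof -
  obtain G where G: "linear G" "\<forall>d\<in>range (flux_div E). flux_div E (G d) = d"
    using linear_exists_right_inverse_on[OF linear_flux_div[of E] subspace_UNIV] by blast
  obtain K where "0 < K" "\<And>d. norm (G d) \<le> K * norm d"
    using linear_bounded_pos[OF G(1)] by blast
  with G that show ?thesis by blast
qed

section \<open>Upwind densities and the graph divergence\<close>

text \<open>If the velocity on an edge is nonzero, both orientations select the density of the same
  node; if it is zero, both products vanish although the selected densities may differ.\<close>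

lemma upwind_antisym:
  assumes "sym E" "velocity_field E v" "(i, j) \<in> E"
  shows "v $ j $ i * upwind v p j i = - (v $ i $ j * upwind v p i j)"
proof -
  have "v $ j $ i = - v $ i $ j"
    using assms(2)[unfolded velocity_field_def, rule_format, of j i] symD[OF assms(1,3)] by simp
  then show ?thesis
    by (auto simp: upwind_def)
qed

lemma upwind_nonneg: "(\<And>i. 0 \<le> p $ i) \<Longrightarrow> 0 \<le> upwind v p i j"
  by (simp add: upwind_def)

lemma upwind_ge: "(\<And>i. c \<le> p $ i) \<Longrightarrow> c \<le> upwind v p i j"
  by (simp add: upwind_def)

lemma upwind_le: "(\<And>i. p $ i \<le> c) \<Longrightarrow> upwind v p i j \<le> c"
  by (simp add: upwind_def)

text \<open>The upwind flux is already antisymmetric, so \<open>flux_div\<close> doubles it; the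
  factor 1/2 compensates.\<close>

lemma graph_div_eq_flux_div:
  assumes "weighted_graph E w" "velocity_field E v"
  shows "graph_div E w p v = flux_div E (\<chi> i j. - (sqrt (w i j) * v $ i $ j * upwind v p i j) / 2)"
proof -
  have "- (sqrt (w i j) * v $ i $ j * upwind v p i j) =
      sqrt (w j i) * v $ j $ i * upwind v p j i / 2 - sqrt (w i j) * v $ i $ j * upwind v p i j / 2"
    if "(i, j) \<in> E" for i j
  proof -
    have "w j i = w i j"
      using assms(1) that by (auto simp: weighted_graph_def)
    then show ?thesis
      using upwind_antisym[OF _ assms(2) that, of p] assms(1) by (auto simp: weighted_graph_def algebra_simps)
  qed
  then show ?thesis
    unfolding graph_div_def flux_div_def vec_eq_iff
    by (auto simp: sum_negf[symmetric] intro!: sum.cong)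
qed

lemma prob_interior_le_1:
  assumes "p \<in> prob_interior"
  shows "p $ i \<le> 1"
proof -
  have "p $ i \<le> (\<Sum>i\<in>UNIV. p $ i)"
    using assms by (intro member_le_sum) (auto simp: prob_interior_iff intro: less_imp_le)
  then show ?thesis
    using assms by (simp add: prob_interior_iff)
qed

lemma prob_interior_nonneg: "p \<in> prob_interior \<Longrightarrow> 0 \<le> p $ i"
  by (simp add: prob_interior_iff less_imp_le)

lemma empirical_prob_interior: "empirical \<in> prob_interior"
  by (simp add: prob_interior_iff empirical_def)

section \<open>Displacement and transport distance\<close>

text \<open>Cauchy-Schwarz at each node, with the upwind density split evenly between the two
  factors. In the factor carrying the weights it is then bounded by 1; the other factors add up to
  the kinetic term.\<close>

lemma sum_graph_div_squared_le:
  fixes E :: "('n::finite \<times> 'n) set"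
  assumes "weighted_graph E w" and "p \<in> prob_interior"
  shows "(\<Sum>i\<in>UNIV. (graph_div E w p v $ i)\<^sup>2) \<le>
    (\<Sum>(i, j)\<in>E. w i j) * (\<Sum>(i, j)\<in>E. upwind v p i j * (v $ i $ j)\<^sup>2)"
proof -
  let ?A = "\<Sum>(i, j)\<in>E. w i j" and ?\<xi> = "upwind v p"
  have \<xi>: "0 \<le> ?\<xi> i j" "?\<xi> i j \<le> 1" for i j
    using assms(2) by (auto intro: upwind_nonneg upwind_le prob_interior_le_1 prob_interior_nonneg)
  have w: "0 \<le> w i j" if "(i, j) \<in> E" for i j
    using assms(1) that by (force simp: weighted_graph_def)
  have "(graph_div E w p v $ i)\<^sup>2 \<le> ?A * (\<Sum>j | (i, j) \<in> E. ?\<xi> i j * (v $ i $ j)\<^sup>2)" for i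
  proof -
    have "(graph_div E w p v $ i)\<^sup>2 =
        (\<Sum>j | (i, j) \<in> E. sqrt (w i j * ?\<xi> i j) * (sqrt (?\<xi> i j) * v $ i $ j))\<^sup>2"
      unfolding graph_div_def
      using \<xi> by (auto simp: real_sqrt_mult mult_ac intro!: arg_cong[where f="\<lambda>x. x\<^sup>2"] sum.cong)
    also have "\<dots> \<le> (\<Sum>j | (i, j) \<in> E. (sqrt (w i j * ?\<xi> i j))\<^sup>2) *
        (\<Sum>j | (i, j) \<in> E. (sqrt (?\<xi> i j) * v $ i $ j)\<^sup>2)"
      by (rule Cauchy_Schwarz_ineq_sum)
    also have "\<dots> = (\<Sum>j | (i, j) \<in> E. w i j * ?\<xi> i j) * (\<Sum>j | (i, j) \<in> E. ?\<xi> i j * (v $ i $ j)\<^sup>2)"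
      using \<xi> w by (auto simp: power_mult_distrib intro!: arg_cong2[where f="(*)"] sum.cong)
    also have "\<dots> \<le> ?A * (\<Sum>j | (i, j) \<in> E. ?\<xi> i j * (v $ i $ j)\<^sup>2)"
    proof (rule mult_right_mono)
      have "(\<Sum>j | (i, j) \<in> E. w i j * ?\<xi> i j) \<le> (\<Sum>j | (i, j) \<in> E. w i j)"
        using \<xi> w by (intro sum_mono) (simp add: mult_left_le)
      also have "\<dots> \<le> ?A"
        unfolding sum_edges using w by (intro member_le_sum[of i UNIV "\<lambda>i. \<Sum>j | (i, j) \<in> E. w i j"]) (auto intro!: sum_nonneg)
      finally show "(\<Sum>j | (i, j) \<in> E. w i j * ?\<xi> i j) \<le> ?A" .
    qed (use \<xi> in \<open>auto intro!: sum_nonneg\<close>)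
    finally show ?thesis .
  qed
  then show ?thesis
    by (subst (2) sum_edges) (simp add: sum_distrib_left sum_mono)
qed

lemma admissible_path_displacement:
  assumes "weighted_graph E w" "admissible_path E w p0 p1 p v"
  shows "p1 - p0 \<in> range (flux_div E)"
proof -
  obtain G where G: "linear G" "\<And>d. d \<in> range (flux_div E) \<Longrightarrow> flux_div E (G d) = d"
    using flux_div_right_inverse[of E] by metis
  \<comment> \<open>This linear defect vanishes exactly on the range of \<open>flux_div E\<close>.
    It is therefore constant along a path whose derivative stays in the range.\<close>
  let ?F = "\<lambda>d. d - flux_div E (G d)"
  have F: "linear ?F"
    by (intro linear_compose_sub linear_id[unfolded id_def] linear_compose[OF G(1) linear_flux_div, unfolded o_def])
  obtain p' where p': "\<And>t. t \<in> {0..1} \<Longrightarrow> (p has_vector_derivative p' t) (at t within {0..1})"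
      "\<And>t. t \<in> {0..1} \<Longrightarrow> p' t + graph_div E w (p t) (v t) = 0"
    and v: "\<And>t. t \<in> {0..1} \<Longrightarrow> velocity_field E (v t)" and ends: "p 0 = p0" "p 1 = p1"
    using assms(2) unfolding admissible_path_def by blast
  have F_const: "((\<lambda>t. ?F (p t)) has_vector_derivative 0) (at t within {0..1})" if t: "t \<in> {0..1}" for t
  proof -
    have "p' t = - graph_div E w (p t) (v t)"
      using p'(2)[OF t] by (simp add: eq_neg_iff_add_eq_0)
    also have "\<dots> \<in> range (flux_div E)"
      unfolding graph_div_eq_flux_div[OF assms(1) v[OF t]]
      by (intro subspace_neg[OF subspace_range_flux_div] rangeI)
    finally have "?F (p' t) = 0"
      using G(2) by simp
    then show ?thesis
      using bounded_linear.has_vector_derivative[OF linear_conv_bounded_linear[THEN iffD1, OF F] p'(1)[OF t]]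
      by simp
  qed
  have "\<exists>c. \<forall>t\<in>{0..1}. ?F (p t) = c"
    by (rule has_vector_derivative_zero_constant[OF convex_real_interval(5) F_const]) auto
  then obtain c where c: "\<And>t. t \<in> {0..1} \<Longrightarrow> ?F (p t) = c"
    by blast
  have "?F (p1 - p0) = ?F (p 1) - ?F (p 0)"
    using linear_diff[OF F] ends by simp
  also have "\<dots> = 0"
    using c[of 0] c[of 1] by simp
  finally show ?thesis
    by (intro range_eqI[of _ _ "G (p1 - p0)"]) simp
qed

text \<open>The infimum over the empty set is infinite, so a finite value provides an admissible
  path.\<close>

lemma GW2_finite_displacement:
  assumes "weighted_graph E w" "GW2 E w p0 p1 < \<infinity>"
  shows "p1 - p0 \<in> range (flux_div E)"
proof -
  have "{path_action E p v | p v. admissible_path E w p0 p1 p v} \<noteq> {}"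
    using assms(2) unfolding GW2_def by (metis Inf_empty less_irrefl infinity_ennreal_def top_ennreal_def)
  then show ?thesis
    using admissible_path_displacement[OF assms(1)] by blast
qed

text \<open>By Jensen's inequality the squared displacement of a coordinate is at most the integral
  of its squared speed, which the kinetic term controls. The summand 1 keeps the denominator
  positive when there are no edges.\<close>

lemma path_action_ge:
  assumes "weighted_graph E w" "admissible_path E w p0 p1 p v"
  shows "ennreal ((p1 $ i - p0 $ i)\<^sup>2 / (2 * (\<Sum>(i, j)\<in>E. w i j) + 1)) \<le> path_action E p v"
proof -
  let ?A = "\<Sum>(i, j)\<in>E. w i j"
  let ?kin = "\<lambda>t. \<Sum>(i, j)\<in>E. upwind (v t) (p t) i j * (v t $ i $ j)\<^sup>2"
  obtain p' where p'cont: "continuous_on {0..1} p'"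
    and p': "\<And>t. t \<in> {0..1} \<Longrightarrow> (p has_vector_derivative p' t) (at t within {0..1})"
      "\<And>t. t \<in> {0..1} \<Longrightarrow> p' t + graph_div E w (p t) (v t) = 0"
    and p: "\<And>t. t \<in> {0..1} \<Longrightarrow> p t \<in> prob_interior" and ends: "p 0 = p0" "p 1 = p1"
    using assms(2) unfolding admissible_path_def by blast
  have A: "0 \<le> ?A"
    using assms(1) by (force intro!: sum_nonneg simp: weighted_graph_def)
  define c where "c = p1 $ i - p0 $ i"
  have "((\<lambda>t. p' t $ i) has_integral c) {0..1}"
    unfolding c_def ends[symmetric]
    by (intro fundamental_theorem_of_calculus bounded_linear.has_vector_derivative[OF bounded_linear_vec_nth] p'(1)) auto
  moreover obtain I where I: "((\<lambda>t. (p' t $ i)\<^sup>2) has_integral I) {0..1}"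
    using integrable_integral[OF integrable_continuous_interval[of 0 1 "\<lambda>t. (p' t $ i)\<^sup>2"]] p'cont
    by (metis continuous_on_component continuous_on_power)
  \<comment> \<open>The integrand is the square of \<open>p' t $ i - c\<close>; its nonnegative
    integral yields Jensen's inequality.\<close>
  ultimately have "((\<lambda>t. (p' t $ i)\<^sup>2 - 2 * c * p' t $ i + c\<^sup>2) has_integral (I - 2 * c * c + c\<^sup>2)) {0..1}"
    using has_integral_const_real[of "c\<^sup>2" 0 1]
    by (intro has_integral_add has_integral_diff has_integral_mult_right) auto
  then have "0 \<le> I - 2 * c * c + c\<^sup>2"
    by (rule has_integral_nonneg) (use zero_le_power2[of "p' _ $ i - c"] in \<open>simp add: power2_diff algebra_simps\<close>)
  then have "c\<^sup>2 \<le> I"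
    by (simp add: power2_eq_square)
  then have "ennreal (c\<^sup>2 / (2 * ?A + 1)) \<le> ennreal (I / (2 * ?A + 1))"
    using A by (intro ennreal_leI divide_right_mono) auto
  also have "\<dots> = (\<integral>\<^sup>+ t\<in>{0..1}. ennreal ((p' t $ i)\<^sup>2 / (2 * ?A + 1)) \<partial>lborel)"
    using A has_integral_divide[OF I, of "2 * ?A + 1"] by (intro nn_integral_has_integral_lebesgue'[symmetric]) auto
  also have "\<dots> \<le> path_action E p v"
    unfolding path_action_def
  proof (rule nn_integral_mono)
    fix t :: real
    have "(p' t $ i)\<^sup>2 / (2 * ?A + 1) \<le> 1 / 2 * ?kin t" if t: "t \<in> {0..1}"
    proof -
      have kin: "0 \<le> ?kin t"
        using p[OF t] by (auto intro!: sum_nonneg mult_nonneg_nonneg upwind_nonneg prob_interior_nonneg)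
      have "p' t = - graph_div E w (p t) (v t)"
        using p'(2)[OF t] by (simp add: eq_neg_iff_add_eq_0)
      then have "(p' t $ i)\<^sup>2 \<le> (\<Sum>i\<in>UNIV. (graph_div E w (p t) (v t) $ i)\<^sup>2)"
        using member_le_sum[of i UNIV "\<lambda>i. (graph_div E w (p t) (v t) $ i)\<^sup>2"] by simp
      also have "\<dots> \<le> ?A * ?kin t"
        by (rule sum_graph_div_squared_le[OF assms(1) p[OF t]])
      finally show ?thesis
        using A kin by (simp add: divide_simps algebra_simps)
    qed
    then show "ennreal ((p' t $ i)\<^sup>2 / (2 * ?A + 1)) * indicator {0..1} t \<le>
        ennreal (1 / 2 * ?kin t) * indicator {0..1} t"
      by (auto simp: indicator_def intro!: ennreal_leI)
  qed
  finally show ?thesis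
    by (simp add: c_def)
qed

text \<open>The lower bound for the action is the same for all admissible paths and so passes to the
  infimum.\<close>

lemma GW2_eq_0_imp_eq:
  assumes "weighted_graph E w" "GW2 E w p0 p1 = 0"
  shows "p1 = p0"
proof -
  have A: "0 \<le> (\<Sum>(i, j)\<in>E. w i j)"
    using assms(1) by (force intro!: sum_nonneg simp: weighted_graph_def)
  have "ennreal ((p1 $ i - p0 $ i)\<^sup>2 / (2 * (\<Sum>(i, j)\<in>E. w i j) + 1)) \<le> GW2 E w p0 p1" for i
    unfolding GW2_def using path_action_ge[OF assms(1)] by (auto intro!: Inf_greatest)
  then have "(p1 $ i - p0 $ i)\<^sup>2 / (2 * (\<Sum>(i, j)\<in>E. w i j) + 1) \<le> 0" for i
    using assms(2) by (metis ennreal_le_epsilon ennreal_eq_0_iff le_zero_eq)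
  then show ?thesis
    using A by (auto simp: vec_eq_iff divide_le_0_iff)
qed

lemma GW2_refl:
  assumes "p \<in> prob_interior"
  shows "GW2 E w p p = 0"
proof -
  have "admissible_path E w p p (\<lambda>_. p) (\<lambda>_. 0)"
    using assms unfolding admissible_path_def
    by (auto simp: velocity_field_def graph_div_def vec_eq_iff intro!: exI[of _ "\<lambda>_. 0"])
  moreover have "path_action E (\<lambda>_. p) (\<lambda>_. 0) = 0"
    by (simp add: path_action_def)
  ultimately have "GW2 E w p p \<le> 0"
    unfolding GW2_def by (metis (mono_tags, lifting) Inf_lower mem_Collect_eq)
  then show ?thesis
    by simp
qed

text \<open>
  The path is the segment from \<open>p0\<close> to \<open>p1\<close> with constant flux. The clamped time in \<open>r\<close>
  keeps the velocity field continuous on all of \<^typ>\<open>real\<close>, which gives its measurability.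
\<close>

lemma GW2_finite:
  fixes E :: "('n::finite \<times> 'n) set"
  assumes "weighted_graph E w" and p0: "p0 \<in> prob_interior" and p1: "p1 \<in> prob_interior"
    and "p1 - p0 \<in> range (flux_div E)"
  shows "GW2 E w p0 p1 < \<infinity>"
proof -
  obtain M where M: "p1 - p0 = flux_div E M"
    using assms(4) by blast
  have sym: "sym E" and w: "\<And>i j. (i, j) \<in> E \<Longrightarrow> 0 < w i j \<and> w i j = w j i"
    using assms(1) by (auto simp: weighted_graph_def)
  define m where "m = (\<lambda>i j. M $ i $ j - M $ j $ i)"
  have m: "m j i = - m i j" for i j
    by (simp add: m_def)
  define p where "p t = p0 + t *\<^sub>R (p1 - p0)" for t
  define r where "r t = p (max 0 (min 1 t))" for t
  \<comment> \<open>The velocity is the prescribed net flux \<open>m\<close> divided by the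
    mobility. The sign of \<open>m\<close> already tells which node the upwind rule will select,
    because dividing by a positive number preserves it.\<close>
  define v :: "real \<Rightarrow> real ^ 'n ^ 'n" where
    "v t = (\<chi> i j. if (i, j) \<in> E then m i j / (sqrt (w i j) * r t $ (if m i j > 0 then j else i)) else 0)" for t
  have p_pos: "p t \<in> prob_interior" if "t \<in> {0..1}" for t
  proof -
    have "0 < (1 - t) * p0 $ i + t * p1 $ i" for i
      using that p0 p1 by (cases "t = 0") (simp_all add: prob_interior_iff add_nonneg_pos less_imp_le)
    then show ?thesis
      using p0 p1 by (auto simp: prob_interior_iff p_def sum.distrib sum_distrib_left[symmetric] sum_subtractf algebra_simps)
  qed
  have r_pos: "0 < r t $ i" for t i
    using p_pos[of "max 0 (min 1 t)"] by (simp add: r_def prob_interior_iff)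
  have r_eq: "r t = p t" if "t \<in> {0..1}" for t
    using that by (simp add: r_def)
  have v_cont: "continuous_on UNIV v"
    unfolding v_def
  proof (intro continuous_on_vec_lambda)
    fix i j
    have "continuous_on UNIV (\<lambda>t. m i j / (sqrt (w i j) * r t $ k))" if "(i, j) \<in> E" for k
      using w[OF that] r_pos[of _ k, THEN less_imp_neq]
      unfolding r_def p_def by (intro continuous_intros) (auto dest: not_sym)
    then show "continuous_on UNIV (\<lambda>t. if (i, j) \<in> E
        then m i j / (sqrt (w i j) * r t $ (if m i j > 0 then j else i)) else 0)"
      by (cases "(i, j) \<in> E") auto
  qed
  have v_field: "velocity_field E (v t)" for t
    unfolding velocity_field_def
  proof (intro allI)
    fix i j
    have "v t $ i $ j = - v t $ j $ i" if "(i, j) \<in> E"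
      using that symD[OF sym that] w[OF that] m[of i j] by (cases "m i j" "0 :: real" rule: linorder_cases) (auto simp: v_def)
    then show "if (i, j) \<in> E then v t $ i $ j = - v t $ j $ i else v t $ i $ j = 0"
      by (simp add: v_def)
  qed
  have sgn_v: "0 < v t $ i $ j \<longleftrightarrow> 0 < m i j" if "(i, j) \<in> E" for t i j
  proof -
    have "v t $ i $ j = m i j / (sqrt (w i j) * r t $ (if 0 < m i j then j else i))"
      using that by (simp add: v_def)
    moreover have "0 < sqrt (w i j) * r t $ (if 0 < m i j then j else i)"
      using w[OF that] r_pos by simp
    ultimately show ?thesis
      by (simp add: zero_less_divide_iff)
  qed
  have flux: "sqrt (w i j) * v t $ i $ j * upwind (v t) (r t) i j = m i j" if "(i, j) \<in> E" for t i j
  proof (cases "0 < m i j")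
    case True
    then show ?thesis
      using that w[OF that] r_pos[of t j] sgn_v[OF that, of t] by (simp add: upwind_def) (simp add: v_def)
  next
    case False
    then show ?thesis
      using that w[OF that] r_pos[of t i] sgn_v[OF that, of t] by (simp add: upwind_def not_less) (simp add: v_def)
  qed
  have "p1 - p0 + graph_div E w (p t) (v t) = 0" if "t \<in> {0..1}" for t
    unfolding M using flux[of _ _ t] r_eq[OF that]
    by (auto simp: vec_eq_iff flux_div_def graph_div_def m_def intro!: sum.cong)
  moreover have "(p has_vector_derivative p1 - p0) (at t within {0..1})" for t
    unfolding p_def by (auto intro!: derivative_eq_intros)
  ultimately have adm: "admissible_path E w p0 p1 p v"
    unfolding admissible_path_def using v_field p_pos v_cont
    by (auto intro!: borel_measurable_continuous_onI exI[of _ "\<lambda>_. p1 - p0"] simp: p_def)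
  \<comment> \<open>Continuity on the compact time interval bounds the velocity, hence the action of
    this path.\<close>
  obtain B where B: "\<And>t. t \<in> {0..1} \<Longrightarrow> norm (v t) \<le> B"
    using compact_imp_bounded[OF compact_continuous_image[OF continuous_on_subset[OF v_cont subset_UNIV] compact_Icc]]
    unfolding bounded_iff by (metis imageI)
  have "path_action E p v \<le> (\<integral>\<^sup>+ t\<in>{0..1::real}. ennreal (1 / 2 * (\<Sum>(i, j)\<in>E. B\<^sup>2)) \<partial>lborel)"
    unfolding path_action_def
  proof (rule nn_integral_mono)
    fix t :: real
    have "upwind (v t) (p t) i j * (v t $ i $ j)\<^sup>2 \<le> B\<^sup>2" if "t \<in> {0..1}" for i j
    proof -
      have "\<bar>v t $ i $ j\<bar> \<le> B"
        using B[OF that] Finite_Cartesian_Product.norm_nth_le[of "v t" i] Finite_Cartesian_Product.norm_nth_le[of "v t $ i" j]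
        by simp
      then have "(v t $ i $ j)\<^sup>2 \<le> B\<^sup>2"
        by (simp add: abs_le_square_iff[symmetric])
      moreover have "0 \<le> upwind (v t) (p t) i j" "upwind (v t) (p t) i j \<le> 1"
        using p_pos[OF that]
        by (auto intro: upwind_nonneg upwind_le prob_interior_le_1 prob_interior_nonneg)
      ultimately show ?thesis
        by (meson mult_left_le_one_le order_trans zero_le_power2)
    qed
    then show "ennreal (1 / 2 * (\<Sum>(i, j)\<in>E. upwind (v t) (p t) i j * (v t $ i $ j)\<^sup>2)) * indicator {0..1} t
        \<le> ennreal (1 / 2 * (\<Sum>(i, j)\<in>E. B\<^sup>2)) * indicator {0..1} t"
      by (auto simp: indicator_def case_prod_unfold simp del: sum_constant intro!: ennreal_leI sum_mono)
  qed
  also have "\<dots> < \<infinity>"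
    by (simp add: nn_integral_cmult_indicator ennreal_mult_less_top)
  finally show ?thesis
    unfolding GW2_def using adm by (auto simp: Inf_less_iff)
qed

section \<open>The free energy and its tangent bounds\<close>

definition free_energy :: "('n::finite \<Rightarrow> real) \<Rightarrow> real \<Rightarrow> real ^ 'n \<Rightarrow> real" where
  "free_energy l \<beta> q = (\<Sum>i\<in>UNIV. q $ i * l i) - \<beta> * (\<Sum>i\<in>UNIV. q $ i * ln (q $ i))"

lemma objective_eq_free_energy:
  "objective loss f x y \<beta> \<theta> q = free_energy (node_loss loss f x y \<theta>) \<beta> q"
  by (simp add: objective_def free_energy_def node_loss_def)

text \<open>The partial derivative of the free energy without its constant term
  \<open>- \<beta>\<close>, which cancels against displacements of total mass zero.\<close>

definition energy_grad :: "('n::finite \<Rightarrow> real) \<Rightarrow> real \<Rightarrow> real ^ 'n \<Rightarrow> 'n \<Rightarrow> real" where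
  "energy_grad l \<beta> q i = l i - \<beta> * ln (q $ i)"

text \<open>This is \<open>ln x \<le> x - 1\<close> at \<open>x = b / a\<close>, multiplied by
  \<open>b\<close>.\<close>

lemma entropy_tangent_upper:
  fixes a b :: real
  assumes "0 < a" "0 < b"
  shows "b * ln b \<le> a * ln a + ln a * (b - a) + (b - a) + (b - a)\<^sup>2 / a"
proof -
  have "b * ln (b / a) \<le> b * (b / a - 1)"
    using assms by (intro mult_left_mono ln_le_minus_one) auto
  also have "\<dots> = (b - a) + (b - a)\<^sup>2 / a"
    using assms by (simp add: field_simps power2_eq_square)
  finally show ?thesis
    using assms by (simp add: ln_div algebra_simps)
qed

text \<open>Strong convexity of the entropy on the unit interval. Applying
  \<open>ln x \<le> x - 1\<close> to the quotient of the square roots leaves the extra term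
  \<open>(t - s)\<^sup>2\<close>; as \<open>t + s \<le> 2\<close>, it dominates a quarter of
  \<open>(b - a)\<^sup>2\<close>.\<close>

lemma entropy_tangent_lower:
  fixes a b :: real
  assumes "0 < a" "0 < b" "a \<le> 1" "b \<le> 1"
  shows "a * ln a + ln a * (b - a) + (b - a) + (b - a)\<^sup>2 / 4 \<le> b * ln b"
proof -
  define s where "s = sqrt a"
  define t where "t = sqrt b"
  have st: "0 < s" "0 < t" "s \<le> 1" "t \<le> 1" "a = s\<^sup>2" "b = t\<^sup>2"
    using assms by (auto simp: s_def t_def)
  have "(b - a)\<^sup>2 = (t - s)\<^sup>2 * (t + s)\<^sup>2"
    unfolding st by (simp add: power2_eq_square algebra_simps)
  also have "\<dots> \<le> (t - s)\<^sup>2 * 2\<^sup>2"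
    using st by (intro mult_left_mono power_mono) auto
  finally have "(b - a) + (b - a)\<^sup>2 / 4 \<le> (t\<^sup>2 - s\<^sup>2) + (t - s)\<^sup>2"
    by (simp add: st)
  also have "\<dots> = - 2 * t\<^sup>2 * (s / t - 1)"
    using st by (simp add: field_simps power2_eq_square)
  also have "\<dots> \<le> - 2 * t\<^sup>2 * ln (s / t)"
    using st ln_le_minus_one[of "s / t"] by (intro mult_left_mono_neg) auto
  also have "\<dots> = b * ln b - b * ln a"
    using st by (simp add: ln_div ln_realpow algebra_simps)
  finally show ?thesis
    by (simp add: algebra_simps)
qed

text \<open>An exact first-order expansion. Its remainder is \<open>\<beta>\<close> times the
  Bregman divergence of the entropy, that is, the relative entropy of \<open>r\<close> with respect
  to \<open>q\<close>.\<close>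

lemma free_energy_diff:
  fixes q r :: "real ^ 'n::finite"
  assumes "(\<Sum>i\<in>UNIV. q $ i) = (\<Sum>i\<in>UNIV. r $ i)"
  shows "free_energy l \<beta> r - free_energy l \<beta> q =
    (\<Sum>i\<in>UNIV. energy_grad l \<beta> q i * (r $ i - q $ i)) -
    \<beta> * (\<Sum>i\<in>UNIV. r $ i * ln (r $ i) - q $ i * ln (q $ i) - ln (q $ i) * (r $ i - q $ i) - (r $ i - q $ i))"
  using assms
  by (simp add: free_energy_def energy_grad_def sum_subtractf sum.distrib sum_distrib_left algebra_simps)

text \<open>Smoothness away from the boundary: the curvature of the entropy at \<open>q\<close> is
  controlled by the lower bound on the densities.\<close>

lemma free_energy_diff_ge:
  fixes q r :: "real ^ 'n::finite"
  assumes "q \<in> prob_interior" "r \<in> prob_interior" "0 \<le> \<beta>" "0 < \<delta>" "\<And>i. \<delta> \<le> q $ i"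
  shows "(\<Sum>i\<in>UNIV. energy_grad l \<beta> q i * (r $ i - q $ i)) - \<beta> / \<delta> * (\<Sum>i\<in>UNIV. (r $ i - q $ i)\<^sup>2)
    \<le> free_energy l \<beta> r - free_energy l \<beta> q"
proof -
  have "r $ i * ln (r $ i) - q $ i * ln (q $ i) - ln (q $ i) * (r $ i - q $ i) - (r $ i - q $ i)
      \<le> (r $ i - q $ i)\<^sup>2 / \<delta>" for i
  proof -
    have "(r $ i - q $ i)\<^sup>2 / q $ i \<le> (r $ i - q $ i)\<^sup>2 / \<delta>"
      using assms by (intro divide_left_mono) (auto simp: prob_interior_iff)
    then show ?thesis
      using entropy_tangent_upper[of "q $ i" "r $ i"] assms by (simp add: prob_interior_iff)
  qed
  then have "\<beta> * (\<Sum>i\<in>UNIV. r $ i * ln (r $ i) - q $ i * ln (q $ i) - ln (q $ i) * (r $ i - q $ i) - (r $ i - q $ i))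
      \<le> \<beta> * (\<Sum>i\<in>UNIV. (r $ i - q $ i)\<^sup>2 / \<delta>)"
    using assms by (intro mult_left_mono sum_mono) auto
  then show ?thesis
    using free_energy_diff[of q r l \<beta>] assms by (simp add: prob_interior_iff flip: sum_divide_distrib)
qed

text \<open>Strong concavity of the free energy, inherited from the entropy.\<close>

lemma free_energy_diff_le:
  fixes q r :: "real ^ 'n::finite"
  assumes "q \<in> prob_interior" "r \<in> prob_interior" "0 \<le> \<beta>"
  shows "free_energy l \<beta> r - free_energy l \<beta> q
    \<le> (\<Sum>i\<in>UNIV. energy_grad l \<beta> q i * (r $ i - q $ i)) - \<beta> / 4 * (\<Sum>i\<in>UNIV. (r $ i - q $ i)\<^sup>2)"
proof -
  have "(r $ i - q $ i)\<^sup>2 / 4 \<le>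
      r $ i * ln (r $ i) - q $ i * ln (q $ i) - ln (q $ i) * (r $ i - q $ i) - (r $ i - q $ i)" for i
    using entropy_tangent_lower[of "q $ i" "r $ i"] assms prob_interior_le_1[of q i] prob_interior_le_1[of r i]
    by (simp add: prob_interior_iff)
  then have "\<beta> * (\<Sum>i\<in>UNIV. (r $ i - q $ i)\<^sup>2 / 4) \<le>
      \<beta> * (\<Sum>i\<in>UNIV. r $ i * ln (r $ i) - q $ i * ln (q $ i) - ln (q $ i) * (r $ i - q $ i) - (r $ i - q $ i))"
    using assms by (intro mult_left_mono sum_mono) auto
  then show ?thesis
    using free_energy_diff[of q r l \<beta>] assms by (simp add: prob_interior_iff flip: sum_divide_distrib)
qed

section \<open>The flow as an ascent of the free energy\<close>

lemma flow_velocity_eq: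
  "(i, j) \<in> E \<Longrightarrow> flow_velocity E l \<beta> q $ i $ j = energy_grad l \<beta> q i - energy_grad l \<beta> q j"
  by (simp add: flow_velocity_def energy_grad_def algebra_simps)

definition driving_field ::
    "('n::finite \<times> 'n) set \<Rightarrow> ('n \<Rightarrow> 'n \<Rightarrow> real) \<Rightarrow> ('n \<Rightarrow> real) \<Rightarrow> real \<Rightarrow> real ^ 'n \<Rightarrow> real ^ 'n ^ 'n" where
  "driving_field E w l \<beta> q = (\<chi> i j. sqrt (w i j) * flow_velocity E l \<beta> q $ i $ j)"

text \<open>Twice the integrand of the action, evaluated at the driving field.\<close>

definition dissipation ::
    "('n::finite \<times> 'n) set \<Rightarrow> ('n \<Rightarrow> 'n \<Rightarrow> real) \<Rightarrow> ('n \<Rightarrow> real) \<Rightarrow> real \<Rightarrow> real ^ 'n \<Rightarrow> real" where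
  "dissipation E w l \<beta> q = (let v = driving_field E w l \<beta> q in \<Sum>(i, j)\<in>E. upwind v q i j * (v $ i $ j)\<^sup>2)"

lemma velocity_field_driving_field:
  assumes "weighted_graph E w"
  shows "velocity_field E (driving_field E w l \<beta> q)"
proof -
  have "w i j = w j i \<and> (j, i) \<in> E" if "(i, j) \<in> E" for i j
    using assms that by (auto simp: weighted_graph_def dest: symD)
  then show ?thesis
    by (auto simp: velocity_field_def driving_field_def flow_velocity_def algebra_simps)
qed

text \<open>Scaling the velocity on an edge by the positive number \<open>sqrt (w i j)\<close> does
  not change its sign, so the upwind densities agree.\<close>

lemma flow_rate_eq_graph_div:
  assumes "weighted_graph E w"
  shows "flow_rate E w l \<beta> q = - graph_div E w q (driving_field E w l \<beta> q)"
proof -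
  have "w i j * flow_velocity E l \<beta> q $ i $ j * upwind (flow_velocity E l \<beta> q) q i j =
      sqrt (w i j) * driving_field E w l \<beta> q $ i $ j * upwind (driving_field E w l \<beta> q) q i j"
    if "(i, j) \<in> E" for i j
  proof -
    have "0 < w i j"
      using assms that by (auto simp: weighted_graph_def)
    then show ?thesis
      by (simp add: upwind_def driving_field_def zero_less_mult_iff mult_le_0_iff)
  qed
  then show ?thesis
    by (auto simp: flow_rate_def graph_div_def vec_eq_iff Let_def intro!: sum.cong)
qed

lemma flow_rate_range:
  assumes "weighted_graph E w"
  shows "flow_rate E w l \<beta> q \<in> range (flux_div E)"
  unfolding flow_rate_eq_graph_div[OF assms]
    graph_div_eq_flux_div[OF assms velocity_field_driving_field[OF assms]]
  by (intro subspace_neg[OF subspace_range_flux_div] rangeI)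

text \<open>The rate at which the flow raises the energy. Summation by parts pairs the flux with the
  difference of \<open>energy_grad\<close> along the edge, to which the flux is itself proportional,
  so squares appear.\<close>

lemma inner_energy_grad_flow_rate:
  assumes "weighted_graph E w"
  shows "(\<Sum>i\<in>UNIV. energy_grad l \<beta> q i * flow_rate E w l \<beta> q $ i) = dissipation E w l \<beta> q / 2"
proof -
  let ?v = "driving_field E w l \<beta> q" and ?g = "energy_grad l \<beta> q"
  have sym: "sym E"
    using assms by (simp add: weighted_graph_def)
  have "(\<Sum>i\<in>UNIV. ?g i * flow_rate E w l \<beta> q $ i) = - (\<Sum>i\<in>UNIV. ?g i * graph_div E w q ?v $ i)"
    by (simp add: flow_rate_eq_graph_div[OF assms] sum_negf)
  also have "\<dots> = (\<Sum>(i, j)\<in>E. sqrt (w i j) * ?v $ i $ j * upwind ?v q i j / 2 * (?g i - ?g j))"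
    unfolding graph_div_eq_flux_div[OF assms velocity_field_driving_field[OF assms]] inner_flux_div[OF sym]
    by (simp add: sum_negf[symmetric] case_prod_unfold)
  also have "\<dots> = (\<Sum>(i, j)\<in>E. upwind ?v q i j * (?v $ i $ j)\<^sup>2 / 2)"
    by (intro sum.cong) (auto simp: flow_velocity_eq[symmetric] driving_field_def[of E w l \<beta> q] power2_eq_square)
  finally show ?thesis
    by (simp add: dissipation_def Let_def sum_divide_distrib case_prod_unfold)
qed

section \<open>A lower bound for the densities along Euler steps\<close>

text \<open>
  The flow obeys a minimum principle for the density of \<open>q\<close> relative to the Gibbs weights, because
  mass moves only towards nodes of smaller relative density; short Euler steps inherit it.
\<close>

definition gibbs_cone :: "('n::finite \<Rightarrow> real) \<Rightarrow> real \<Rightarrow> real \<Rightarrow> (real ^ 'n) set" where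
  "gibbs_cone l \<beta> m = {q. (\<Sum>i\<in>UNIV. q $ i) = 1 \<and> (\<forall>i. m * exp (l i / \<beta>) \<le> q $ i)}"

lemma gibbs_cone_prob_interior:
  assumes "0 < m"
  shows "gibbs_cone l \<beta> m \<subseteq> prob_interior"
proof
  fix q :: "real ^ 'a"
  assume q: "q \<in> gibbs_cone l \<beta> m"
  have "0 < m * exp (l i / \<beta>)" for i
    using assms by simp
  then have "0 < q $ i" for i
    using q by (auto simp: gibbs_cone_def intro: less_le_trans)
  then show "q \<in> prob_interior"
    using q by (simp add: gibbs_cone_def prob_interior_iff)
qed

text \<open>If \<open>q $ i\<close> is \<open>z\<close> times its lower bound \<open>e\<close>, the
  velocity out of node \<open>i\<close> along an edge is at most
  \<open>\<beta> * ln z \<le> \<beta> * (z - 1)\<close>. The loss in one step is thus proportional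
  to the excess \<open>z - 1\<close>, and the bound on \<open>\<tau>\<close> makes it at most the
  excess mass \<open>(z - 1) * e\<close>.\<close>

lemma gibbs_cone_step:
  fixes E :: "('n::finite \<times> 'n) set"
  assumes wg: "weighted_graph E w" and "0 < \<beta>" "0 < m" and q: "q \<in> gibbs_cone l \<beta> m"
    and "0 \<le> \<tau>" and \<tau>: "\<And>i. \<tau> * (\<beta> * (\<Sum>(i, j)\<in>E. w i j)) \<le> m * exp (l i / \<beta>)"
  shows "q + \<tau> *\<^sub>R flow_rate E w l \<beta> q \<in> gibbs_cone l \<beta> m"
proof -
  let ?A = "\<Sum>(i, j)\<in>E. w i j" and ?v = "flow_velocity E l \<beta> q"
  have sym: "sym E" and w: "\<And>i j. (i, j) \<in> E \<Longrightarrow> 0 < w i j"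
    using wg by (auto simp: weighted_graph_def)
  have qi: "q \<in> prob_interior"
    using q gibbs_cone_prob_interior[OF \<open>0 < m\<close>] by blast
  have q0: "0 < q $ i" and q1: "q $ i \<le> 1" for i
    using qi prob_interior_le_1[OF qi] by (auto simp: prob_interior_iff)
  have "m * exp (l i / \<beta>) \<le> q $ i + \<tau> * flow_rate E w l \<beta> q $ i" for i
  proof -
    define e where "e = m * exp (l i / \<beta>)"
    define z where "z = q $ i / e"
    have e: "0 < e" "e \<le> q $ i"
      using q \<open>0 < m\<close> by (auto simp: e_def gibbs_cone_def)
    have z: "1 \<le> z" "q $ i = z * e"
      using e by (auto simp: z_def)
    have *: "- (\<beta> * (z - 1)) * w i j \<le> w i j * ?v $ i $ j * upwind ?v q i j" if "(i, j) \<in> E" for j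
    proof -
      have lower: "- (\<beta> * (z - 1)) \<le> ?v $ i $ j * upwind ?v q i j"
      proof (cases "?v $ i $ j > 0")
        case True
        then have "0 \<le> ?v $ i $ j * upwind ?v q i j"
          by (intro mult_nonneg_nonneg upwind_nonneg prob_interior_nonneg[OF qi]) simp
        moreover have "0 \<le> \<beta> * (z - 1)"
          using z \<open>0 < \<beta>\<close> by simp
        ultimately show ?thesis
          by linarith
      next
        case False
        \<comment> \<open>Mass leaves node \<open>i\<close> here. Inserting the lower bound of the
          neighbour \<open>j\<close> cancels the losses and \<open>ln m\<close> from the velocity,
          leaving \<open>- \<beta> * ln z\<close> as a lower bound.\<close>
        have "m * exp (l j / \<beta>) \<le> q $ j"
          using q by (simp add: gibbs_cone_def)
        then have "ln (m * exp (l j / \<beta>)) \<le> ln (q $ j)"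
          using \<open>0 < m\<close> by (intro ln_mono) auto
        then have "\<beta> * ln m + l j \<le> \<beta> * ln (q $ j)"
          using \<open>0 < \<beta>\<close> \<open>0 < m\<close> by (simp add: ln_mult field_simps)
        moreover have "\<beta> * ln z = \<beta> * ln (q $ i) - \<beta> * ln m - l i"
          using \<open>0 < \<beta>\<close> \<open>0 < m\<close> q0[of i] by (simp add: z_def e_def ln_mult ln_div field_simps)
        moreover have "\<beta> * ln z \<le> \<beta> * (z - 1)"
          using z \<open>0 < \<beta>\<close> by (intro mult_left_mono ln_le_minus_one) auto
        ultimately have lb: "- (\<beta> * (z - 1)) \<le> ?v $ i $ j"
          using that by (simp add: flow_velocity_def algebra_simps)
        also have "?v $ i $ j \<le> ?v $ i $ j * upwind ?v q i j"
          using False q1[of i] mult_left_mono_neg[of "q $ i" 1 "?v $ i $ j"] by (simp add: upwind_def)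
        finally show ?thesis .
      qed
      show ?thesis
        using mult_left_mono[OF lower, of "w i j"] w[OF that] by (simp add: mult_ac)
    qed
    have "(\<Sum>j | (i, j) \<in> E. w i j) \<le> ?A"
      unfolding sum_edges using w[THEN less_imp_le]
      by (intro member_le_sum[of i UNIV "\<lambda>i. \<Sum>j | (i, j) \<in> E. w i j"]) (auto intro!: sum_nonneg)
    then have "- (\<beta> * (z - 1)) * ?A \<le> - (\<beta> * (z - 1)) * (\<Sum>j | (i, j) \<in> E. w i j)"
      using z \<open>0 < \<beta>\<close> by (intro mult_left_mono_neg) auto
    also have "\<dots> \<le> flow_rate E w l \<beta> q $ i"
      using * by (auto simp: flow_rate_def Let_def sum_distrib_left intro!: sum_mono)
    finally have "\<tau> * (- (\<beta> * (z - 1)) * ?A) \<le> \<tau> * flow_rate E w l \<beta> q $ i"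
      using \<open>0 \<le> \<tau>\<close> by (intro mult_left_mono) auto
    moreover have "(z - 1) * (\<tau> * (\<beta> * ?A)) \<le> (z - 1) * e"
      using \<tau>[of i] z by (intro mult_left_mono) (auto simp: e_def)
    ultimately show ?thesis
      unfolding e_def[symmetric] z(2) by (simp add: algebra_simps)
  qed
  moreover have "(\<Sum>i\<in>UNIV. flow_rate E w l \<beta> q $ i) = 0"
    using flow_rate_range[OF wg, of l \<beta> q] sum_flux_div[OF sym] by auto
  ultimately show ?thesis
    using q by (simp add: gibbs_cone_def sum.distrib sum_distrib_left[symmetric])
qed

section \<open>Energy gain and energy gap in terms of dissipation\<close>

lemma dissipation_nonneg: "(\<And>i. 0 \<le> q $ i) \<Longrightarrow> 0 \<le> dissipation E w l \<beta> q"
  by (auto simp: dissipation_def Let_def intro!: sum_nonneg upwind_nonneg mult_nonneg_nonneg)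

text \<open>The first-order gain is \<open>\<tau> / 2\<close> times the dissipation; the step size
  restriction lets the second-order loss consume at most half of it.\<close>

lemma free_energy_step:
  fixes E :: "('n::finite \<times> 'n) set"
  assumes wg: "weighted_graph E w" and "0 < \<beta>" and q: "q \<in> prob_interior"
    and r: "q + \<tau> *\<^sub>R flow_rate E w l \<beta> q \<in> prob_interior"
    and \<delta>: "0 < \<delta>" "\<And>i. \<delta> \<le> q $ i"
    and "0 \<le> \<tau>" and \<tau>: "4 * \<tau> * (\<beta> * (\<Sum>(i, j)\<in>E. w i j)) \<le> \<delta>"
  shows "free_energy l \<beta> q + \<tau> / 4 * dissipation E w l \<beta> q
    \<le> free_energy l \<beta> (q + \<tau> *\<^sub>R flow_rate E w l \<beta> q)"
proof -
  let ?A = "\<Sum>(i, j)\<in>E. w i j" and ?r = "flow_rate E w l \<beta> q" and ?D = "dissipation E w l \<beta> q"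
  have D: "0 \<le> ?D"
    using q by (intro dissipation_nonneg prob_interior_nonneg)
  have "(\<Sum>i\<in>UNIV. (?r $ i)\<^sup>2) \<le> ?A * ?D"
    using sum_graph_div_squared_le[OF wg q, of "driving_field E w l \<beta> q"]
    by (simp add: flow_rate_eq_graph_div[OF wg] dissipation_def Let_def)
  then have "\<beta> / \<delta> * (\<tau>\<^sup>2 * (\<Sum>i\<in>UNIV. (?r $ i)\<^sup>2)) \<le> \<beta> / \<delta> * (\<tau>\<^sup>2 * (?A * ?D))"
    using \<open>0 < \<beta>\<close> \<delta> by (intro mult_left_mono) auto
  also have "\<dots> = (4 * \<tau> * (\<beta> * ?A)) * (\<tau> * ?D / (4 * \<delta>))"
    by (simp add: power2_eq_square)
  also have "\<dots> \<le> \<delta> * (\<tau> * ?D / (4 * \<delta>))"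
    using D \<delta> \<open>0 \<le> \<tau>\<close> by (intro mult_right_mono[OF \<tau>]) auto
  also have "\<dots> = \<tau> / 4 * ?D"
    using \<delta> by simp
  finally have "\<beta> / \<delta> * (\<Sum>i\<in>UNIV. (\<tau> * ?r $ i)\<^sup>2) \<le> \<tau> / 4 * ?D"
    by (simp add: power_mult_distrib sum_distrib_left)
  moreover have "(\<Sum>i\<in>UNIV. energy_grad l \<beta> q i * (\<tau> * ?r $ i)) = \<tau> * (?D / 2)"
    unfolding inner_energy_grad_flow_rate[OF wg, symmetric] by (simp add: sum_distrib_left mult_ac)
  moreover have "(\<Sum>i\<in>UNIV. energy_grad l \<beta> q i * (\<tau> * ?r $ i)) - \<beta> / \<delta> * (\<Sum>i\<in>UNIV. (\<tau> * ?r $ i)\<^sup>2)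
      \<le> free_energy l \<beta> (q + \<tau> *\<^sub>R ?r) - free_energy l \<beta> q"
    using free_energy_diff_ge[OF q r _ \<delta>, of \<beta> l] \<open>0 < \<beta>\<close> by simp
  ultimately show ?thesis
    by linarith
qed

text \<open>
  A Polyak-Lojasiewicz inequality: the displacement \<open>r - q\<close> is the divergence of a flux bounded by it,
  so the first-order gain is at most a multiple of \<open>norm (r - q)\<close> times the norm of the velocity, and
  the quadratic gap left by strong concavity of the entropy absorbs the first factor.
\<close>

lemma free_energy_gap_le_dissipation:
  fixes E :: "('n::finite \<times> 'n) set"
  assumes wg: "weighted_graph E w" and "0 < \<beta>" "0 < \<delta>"
  obtains c where "0 < c" "\<And>q r. \<lbrakk>q \<in> prob_interior; r \<in> prob_interior; r - q \<in> range (flux_div E);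
      \<And>i. \<delta> \<le> q $ i\<rbrakk> \<Longrightarrow> free_energy l \<beta> r - free_energy l \<beta> q \<le> c * dissipation E w l \<beta> q"
proof -
  have sym: "sym E" and w: "\<And>i j. (i, j) \<in> E \<Longrightarrow> 0 < w i j"
    using wg by (auto simp: weighted_graph_def)
  obtain G K where GK: "0 < K" "\<And>d. norm (G d) \<le> K * norm d"
      "\<And>d. d \<in> range (flux_div E) \<Longrightarrow> flux_div E (G d) = d"
    using flux_div_right_inverse[of E] by metis
  \<comment> \<open>A positive lower bound for the weights; the inserted 1 makes the minimum exist
    for an empty edge set.\<close>
  define b where "b = Min (insert 1 ((\<lambda>(i, j). w i j) ` E))"
  have b: "0 < b" "\<And>i j. (i, j) \<in> E \<Longrightarrow> b \<le> w i j"
    unfolding b_def using w by (auto simp: Min_gr_iff intro!: Min_le)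
  \<comment> \<open>Chosen so that \<open>\<kappa> * K\<^sup>2 = \<beta> / 4\<close>, the
    coefficient of the quadratic term in \<open>free_energy_diff_le\<close>.\<close>
  define \<kappa> where "\<kappa> = \<beta> / (4 * K\<^sup>2)"
  have \<kappa>: "0 < \<kappa>"
    using \<open>0 < \<beta>\<close> GK by (simp add: \<kappa>_def)
  have gap: "free_energy l \<beta> r - free_energy l \<beta> q \<le> 1 / (4 * \<kappa> * b * \<delta>) * dissipation E w l \<beta> q"
    if q: "q \<in> prob_interior" and r: "r \<in> prob_interior"
      and d: "r - q \<in> range (flux_div E)" and \<delta>: "\<And>i. \<delta> \<le> q $ i" for q r
  proof -
    let ?M = "G (r - q)" and ?v = "flow_velocity E l \<beta> q" and ?u = "driving_field E w l \<beta> q"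
    have "(\<Sum>i\<in>UNIV. energy_grad l \<beta> q i * (r $ i - q $ i)) =
        (\<Sum>i\<in>UNIV. energy_grad l \<beta> q i * flux_div E ?M $ i)"
      using GK(3)[OF d] by simp
    also have "\<dots> = (\<Sum>(i, j)\<in>E. ?M $ i $ j * ?v $ i $ j)"
      unfolding inner_flux_div[OF sym] by (intro sum.cong) (auto simp: flow_velocity_eq)
    \<comment> \<open>Young's inequality with parameter \<open>\<kappa>\<close> separates the flux
      from the velocity.\<close>
    also have "\<dots> \<le> (\<Sum>(i, j)\<in>E. \<kappa> * (?M $ i $ j)\<^sup>2 + (?v $ i $ j)\<^sup>2 / (4 * \<kappa>))"
    proof (intro sum_mono, clarify)
      fix i j
      have "0 \<le> (2 * \<kappa> * ?M $ i $ j - ?v $ i $ j)\<^sup>2 / (4 * \<kappa>)"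
        using \<kappa> by simp
      also have "\<dots> = \<kappa> * (?M $ i $ j)\<^sup>2 + (?v $ i $ j)\<^sup>2 / (4 * \<kappa>) - ?M $ i $ j * ?v $ i $ j"
        using \<kappa> by (simp add: field_simps power2_eq_square)
      finally show "?M $ i $ j * ?v $ i $ j \<le> \<kappa> * (?M $ i $ j)\<^sup>2 + (?v $ i $ j)\<^sup>2 / (4 * \<kappa>)"
        by simp
    qed
    also have "\<dots> = \<kappa> * (\<Sum>(i, j)\<in>E. (?M $ i $ j)\<^sup>2) + (\<Sum>(i, j)\<in>E. (?v $ i $ j)\<^sup>2) / (4 * \<kappa>)"
      by (simp add: case_prod_unfold sum.distrib sum_distrib_left sum_divide_distrib)
    finally have lin: "(\<Sum>i\<in>UNIV. energy_grad l \<beta> q i * (r $ i - q $ i)) \<le>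
        \<kappa> * (\<Sum>(i, j)\<in>E. (?M $ i $ j)\<^sup>2) + (\<Sum>(i, j)\<in>E. (?v $ i $ j)\<^sup>2) / (4 * \<kappa>)" .
    have norm_sq: "(norm z)\<^sup>2 = (\<Sum>i\<in>UNIV. (norm (z $ i))\<^sup>2)" for z :: "'z::real_normed_vector ^ 'n"
      by (simp add: norm_vec_def L2_set_def sum_nonneg)
    have "(\<Sum>(i, j)\<in>E. (?M $ i $ j)\<^sup>2) \<le> (\<Sum>(i, j)\<in>UNIV. (?M $ i $ j)\<^sup>2)"
      by (intro sum_mono2) auto
    also have "\<dots> = (norm ?M)\<^sup>2"
      by (simp add: norm_sq sum_edges)
    also have "\<dots> \<le> (K * norm (r - q))\<^sup>2"
      by (intro power_mono GK(2)) auto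
    also have "\<dots> = K\<^sup>2 * (\<Sum>i\<in>UNIV. (r $ i - q $ i)\<^sup>2)"
      by (simp add: power_mult_distrib norm_sq)
    finally have "\<kappa> * (\<Sum>(i, j)\<in>E. (?M $ i $ j)\<^sup>2) \<le> \<kappa> * (K\<^sup>2 * (\<Sum>i\<in>UNIV. (r $ i - q $ i)\<^sup>2))"
      using \<kappa> by (intro mult_left_mono) auto
    also have "\<dots> = \<beta> / 4 * (\<Sum>i\<in>UNIV. (r $ i - q $ i)\<^sup>2)"
      using GK(1) by (simp add: \<kappa>_def)
    finally have quad: "\<kappa> * (\<Sum>(i, j)\<in>E. (?M $ i $ j)\<^sup>2) \<le> \<beta> / 4 * (\<Sum>i\<in>UNIV. (r $ i - q $ i)\<^sup>2)" .
    \<comment> \<open>Each edge has weight at least \<open>b\<close> and upwind density at least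
      \<open>\<delta>\<close>, so the dissipation controls all velocities.\<close>
    have "b * \<delta> * (\<Sum>(i, j)\<in>E. (?v $ i $ j)\<^sup>2) \<le> dissipation E w l \<beta> q"
      unfolding dissipation_def Let_def sum_distrib_left
    proof (intro sum_mono, clarify)
      fix i j assume ij: "(i, j) \<in> E"
      have "b * \<delta> \<le> w i j * upwind ?u q i j"
        using b ij \<open>0 < \<delta>\<close> w[OF ij] upwind_ge[OF \<delta>] by (intro mult_mono) auto
      then have "b * \<delta> * (?v $ i $ j)\<^sup>2 \<le> w i j * upwind ?u q i j * (?v $ i $ j)\<^sup>2"
        by (intro mult_right_mono) auto
      also have "\<dots> = upwind ?u q i j * (?u $ i $ j)\<^sup>2"
        using w[OF ij] by (simp add: driving_field_def[of E w l \<beta> q] power_mult_distrib)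
      finally show "b * \<delta> * (?v $ i $ j)\<^sup>2 \<le> upwind ?u q i j * (?u $ i $ j)\<^sup>2" .
    qed
    then have "(\<Sum>(i, j)\<in>E. (?v $ i $ j)\<^sup>2) / (4 * \<kappa>) \<le> 1 / (4 * \<kappa> * b * \<delta>) * dissipation E w l \<beta> q"
      using \<kappa> b \<open>0 < \<delta>\<close> by (simp add: field_simps)
    then show ?thesis
      using lin quad free_energy_diff_le[OF q r, of \<beta> l] \<open>0 < \<beta>\<close> by linarith
  qed
  show thesis
    by (rule that[OF _ gap]) (use \<kappa> b \<open>0 < \<delta>\<close> in auto)
qed

section \<open>Geometric decay of the energy gap\<close>

text \<open>\<open>C\<close> is chosen after \<open>\<tau>\<close> because the contraction per step
  is tied to the step size. The denominator has to be nonzero for the quotient to be meaningful: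
  constant node losses, for instance, make the empirical distribution stationary, and numerator and
  denominator both vanish.\<close>

theorem theorem2:
  fixes E :: "('n::finite \<times> 'n) set" and w :: "'n \<Rightarrow> 'n \<Rightarrow> real"
    and loss :: "'c \<Rightarrow> 'b \<Rightarrow> real" and f :: "'t \<Rightarrow> 'a \<Rightarrow> 'c"
    and x :: "'n \<Rightarrow> 'a" and y :: "'n \<Rightarrow> 'b" and \<beta> :: real and \<theta> :: 't
  assumes "weighted_graph E w" and "\<beta> > 0"
  shows "\<exists>\<tau>\<^sub>0>0. \<forall>\<tau>. 0 < \<tau> \<and> \<tau> < \<tau>\<^sub>0 \<longrightarrow>
    (\<exists>C>0. \<forall>T qstar.
       let L = objective loss f x y \<beta> \<theta>;
           qT = flow_iterate E w (node_loss loss f x y \<theta>) \<beta> \<tau> T;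
           \<epsilon> = GW2 E w empirical qT
       in worst_case E w L \<epsilon> qstar \<and> L qstar - L empirical \<noteq> 0 \<longrightarrow>
          (L qT - L empirical) / (L qstar - L empirical) > 1 - exp (- C * real T))"
proof -
  define l where "l = node_loss loss f x y \<theta>"
  define L where "L = free_energy l \<beta>"
  have L: "objective loss f x y \<beta> \<theta> = L"
    by (simp add: L_def l_def objective_eq_free_energy fun_eq_iff)
  define A where "A = (\<Sum>(i, j)\<in>E. w i j)"
  have A: "0 \<le> A"
    unfolding A_def using assms(1) by (force intro!: sum_nonneg simp: weighted_graph_def)
  \<comment> \<open>The largest \<open>m\<close> for which the uniform starting point lies in
    \<open>gibbs_cone l \<beta> m\<close>.\<close>
  define m where "m = 1 / (real CARD('n) * exp (Max (range l) / \<beta>))"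
  define \<delta> where "\<delta> = m * exp (Min (range l) / \<beta>)"
  have m: "0 < m" and \<delta>: "0 < \<delta>"
    by (auto simp: m_def \<delta>_def)
  have \<delta>_le: "\<delta> \<le> m * exp (l i / \<beta>)" for i
    unfolding \<delta>_def using m \<open>0 < \<beta>\<close> by (intro mult_left_mono) (auto simp: divide_right_mono)
  have m_le: "m * exp (l i / \<beta>) \<le> 1 / real CARD('n)" for i
  proof -
    have "m * exp (l i / \<beta>) \<le> m * exp (Max (range l) / \<beta>)"
      using m \<open>0 < \<beta>\<close> by (intro mult_left_mono) (auto simp: divide_right_mono)
    then show ?thesis
      by (simp add: m_def)
  qed
  obtain c1 where c1: "0 < c1" and PL: "\<And>q r. \<lbrakk>q \<in> prob_interior; r \<in> prob_interior;
      r - q \<in> range (flux_div E); \<And>i. \<delta> \<le> q $ i\<rbrakk> \<Longrightarrow> L r - L q \<le> c1 * dissipation E w l \<beta> q"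
    using free_energy_gap_le_dissipation[OF assms \<delta>, of l] unfolding L_def by metis
  \<comment> \<open>The factor 4 serves the energy gain and also implies the condition for
    invariance of the cone; the summand 1 keeps the denominator positive when
    \<open>A = 0\<close>.\<close>
  define \<tau>0 where "\<tau>0 = \<delta> / (4 * (\<beta> * A + 1))"
  have "0 < \<tau>0"
    using \<delta> A \<open>0 < \<beta>\<close> by (simp add: \<tau>0_def add_nonneg_pos)
  moreover have "\<exists>C>0. \<forall>T qstar. let qT = flow_iterate E w l \<beta> \<tau> T; \<epsilon> = GW2 E w empirical qT
       in worst_case E w L \<epsilon> qstar \<and> L qstar - L empirical \<noteq> 0 \<longrightarrow>
          (L qT - L empirical) / (L qstar - L empirical) > 1 - exp (- C * real T)"
    if \<tau>: "0 < \<tau>" "\<tau> < \<tau>0" for \<tau>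
  proof -
    define Q where "Q = flow_iterate E w l \<beta> \<tau>"
    have Q_Suc: "Q (Suc t) = Q t + \<tau> *\<^sub>R flow_rate E w l \<beta> (Q t)" for t
      by (simp add: Q_def)
    have Q_0: "Q 0 = empirical"
      by (simp add: Q_def)
    have "0 < 4 * (\<beta> * A + 1)"
      using A \<open>0 < \<beta>\<close> by (simp add: add_nonneg_pos)
    then have "\<tau> * (4 * (\<beta> * A + 1)) \<le> \<delta>"
      using \<tau> unfolding \<tau>0_def by (simp only: pos_less_divide_eq less_imp_le)
    then have small: "4 * \<tau> * (\<beta> * A) \<le> \<delta>"
      using \<tau> by (simp add: algebra_simps)
    have cone: "Q t \<in> gibbs_cone l \<beta> m" for t
    proof (induction t)
      case 0
      show ?case
        using m_le by (simp add: Q_0 gibbs_cone_def empirical_def)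
    next
      case (Suc t)
      have "0 \<le> \<tau> * (\<beta> * A)"
        using \<tau> A \<open>0 < \<beta>\<close> by simp
      then have "\<tau> * (\<beta> * A) \<le> m * exp (l i / \<beta>)" for i
        using small \<delta>_le[of i] by linarith
      then show ?case
        unfolding Q_Suc using \<tau> by (intro gibbs_cone_step[OF assms m Suc.IH]) (auto simp: A_def)
    qed
    have Q: "Q t \<in> prob_interior" "\<delta> \<le> Q t $ i" for t i
      using cone[of t] gibbs_cone_prob_interior[OF m, of l \<beta>] \<delta>_le[of i] by (auto simp: gibbs_cone_def intro: order_trans)
    note sub = subspace_range_flux_div[of E]
    have Q_range: "Q t - empirical \<in> range (flux_div E)" for t
    proof (induction t)
      case 0
      show ?case
        using subspace_0[OF sub] by (simp add: Q_0)
    next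
      case (Suc t)
      have "(Q t - empirical) + \<tau> *\<^sub>R flow_rate E w l \<beta> (Q t) \<in> range (flux_div E)"
        by (intro subspace_add[OF sub] subspace_scale[OF sub] flow_rate_range[OF assms(1)] Suc.IH)
      then show ?case
        by (simp add: Q_Suc algebra_simps)
    qed
    have gain: "L (Q t) + \<tau> / 4 * dissipation E w l \<beta> (Q t) \<le> L (Q (Suc t))" for t
      unfolding Q_Suc L_def
      by (rule free_energy_step[OF assms Q(1) _ \<delta> Q(2)]) (use Q(1)[of "Suc t"] \<tau> small in \<open>auto simp: Q_Suc A_def\<close>)
    \<comment> \<open>With \<open>c * c1 \<le> \<tau> / 4\<close> the gain of a step is at least
      \<open>c\<close> times the current gap; the cap 1/2 keeps \<open>1 - c\<close>
      positive.\<close>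
    define c where "c = min (\<tau> / (4 * c1)) (1 / 2)"
    have c: "0 < c" "c < 1" "c * c1 \<le> \<tau> / 4"
      using \<tau> c1 by (auto simp: c_def min_def field_simps)
    have "1 - exp (- (c / 2) * real T) < (L (Q T) - L empirical) / (L r - L empirical)"
      if wc: "worst_case E w L (GW2 E w empirical (Q T)) r" and ne: "L r - L empirical \<noteq> 0" for T r
    proof -
      have r: "r \<in> prob_interior" "GW2 E w empirical r \<le> GW2 E w empirical (Q T)"
        using wc by (auto simp: worst_case_def is_arg_max_def)
      \<comment> \<open>The empirical distribution itself competes in the ball, so the denominator
        cannot be negative.\<close>
      have "GW2 E w empirical empirical \<le> GW2 E w empirical (Q T)"
        by (simp add: GW2_refl empirical_prob_interior)
      then have "\<not> L r < L empirical"
        using wc empirical_prob_interior by (auto simp: worst_case_def is_arg_max_def)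
      then have pos: "0 < L r - L empirical"
        using ne by simp
      \<comment> \<open>The iterate is reached by edge fluxes, so the radius is finite; every point
        of the ball is then reachable as well, and the gap estimate applies to
        \<open>r\<close>.\<close>
      have "GW2 E w empirical (Q T) < \<infinity>"
        by (intro GW2_finite[OF assms(1)] Q empirical_prob_interior Q_range)
      then have r_range: "r - empirical \<in> range (flux_div E)"
        using r(2) by (intro GW2_finite_displacement[OF assms(1)]) auto
      have contract: "L r - L (Q t) \<le> (1 - c) ^ t * (L r - L empirical)" for t
      proof (induction t)
        case 0
        show ?case
          by (simp add: Q_0)
      next
        case (Suc t)
        let ?D = "dissipation E w l \<beta> (Q t)"
        have D: "0 \<le> ?D"
          using Q(1)[of t] by (intro dissipation_nonneg prob_interior_nonneg)
        have "r - Q t \<in> range (flux_div E)"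
          using subspace_diff[OF sub r_range Q_range[of t]] by simp
        then have "c * (L r - L (Q t)) \<le> c * (c1 * ?D)"
          using c by (intro mult_left_mono PL Q r) auto
        also have "\<dots> \<le> \<tau> / 4 * ?D"
          using mult_right_mono[OF c(3) D] by (simp add: mult_ac)
        finally have "L r - L (Q (Suc t)) \<le> (1 - c) * (L r - L (Q t))"
          using gain[of t] by (simp add: algebra_simps)
        also have "\<dots> \<le> (1 - c) * ((1 - c) ^ t * (L r - L empirical))"
          using c by (intro mult_left_mono Suc.IH) auto
        finally show ?case
          by (simp add: mult_ac)
      qed
      \<comment> \<open>Strictness comes from comparing powers of different bases, which requires a
        positive exponent.\<close>
      have "T \<noteq> 0"
      proof
        assume "T = 0"
        then have "GW2 E w empirical r = 0"
          using r(2) by (simp add: Q_0 GW2_refl empirical_prob_interior)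
        then show False
          using ne GW2_eq_0_imp_eq[OF assms(1)] by auto
      qed
      \<comment> \<open>Halving the rate makes the inequality strict:
        \<open>1 - c < 1 - c / 2 \<le> exp (- (c / 2))\<close>.\<close>
      have "1 - c < exp (- (c / 2))"
        using exp_ge_add_one_self[of "- (c / 2)"] c by linarith
      then have "(1 - c) ^ T < exp (- (c / 2)) ^ T"
        using c \<open>T \<noteq> 0\<close> by (intro power_strict_mono) auto
      also have "\<dots> = exp (- (c / 2) * real T)"
        by (simp add: exp_of_nat_mult[symmetric] mult_ac)
      finally have "(1 - c) ^ T * (L r - L empirical) < exp (- (c / 2) * real T) * (L r - L empirical)"
        using pos by (intro mult_strict_right_mono)
      then have "(1 - exp (- (c / 2) * real T)) * (L r - L empirical) < L (Q T) - L empirical"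
        using contract[of T] by (simp add: algebra_simps)
      then show ?thesis
        by (simp only: pos_less_divide_eq[OF pos])
    qed
    then show ?thesis
      using c unfolding Q_def by (intro exI[of _ "c / 2"]) (auto simp: Let_def)
  qed
  ultimately show ?thesis
    unfolding L l_def[symmetric] Let_def by blast
qed

end
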